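(* Suppose $\mathcal{H}$ is a complex Hilbert space of dimension at least $3$ and $T \in \mathcal{B}(\mathcal{H})$ is a nonzero operator such that $T+T^*$ is positive semidefinite. Suppose $T$ attains its norm at a unit vector $x\in \mathcal{H}$, i.e., $\|T(x)\| = \|T\|$. Then $\|T\|/w(T)=\sqrt 2$ if and only if the compression of the operator $\tilde T = T/\|T\|$ onto the subspace spanned by $x$ and $T(x)$ is unitarily similar to the matrix $$B = \begin{pmatrix} 2/3 & 1/\sqrt{3}\\ -1/\sqrt{3} & 0 \end{pmatrix}$$ and $w(\tilde T) \le 1/\sqrt 2$.
   Context: $\mathcal{B}(\mathcal{H})$ is the set of bounded linear operators on $\mathcal{H}$ and $\|\cdot\|$ is the operator norm. The numerical range of $T$ is $W(T)=\{\langle Ty,y\rangle : y\in\mathcal{H}, \|y\|=1\}$ and the numerical radius is $w(T)=\sup\{|\mu|:\mu\in W(T)\}$. The compression of an operator $X$ onto a closed subspace $V$ is $P_V X|_V : V\to V$, where $P_V$ is the orthogonal projection onto $V$. *)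

theory Defs
  imports "HOL-Analysis.Analysis"
begin

section \<open>Complex Hilbert spaces\<close>

class complex_vector = real_vector +
  fixes scaleC :: "complex \<Rightarrow> 'a \<Rightarrow> 'a" (infixr "*\<^sub>C" 75)
  assumes scaleC_add_right: "a *\<^sub>C (x + y) = a *\<^sub>C x + a *\<^sub>C y"
    and scaleC_add_left: "(a + b) *\<^sub>C x = a *\<^sub>C x + b *\<^sub>C x"
    and scaleC_scaleC: "a *\<^sub>C (b *\<^sub>C x) = (a * b) *\<^sub>C x"
    and scaleC_one: "1 *\<^sub>C x = x"
    and scaleC_of_real: "complex_of_real r *\<^sub>C x = r *\<^sub>R x"

global_interpretation complex_vector:
  vector_space "scaleC :: complex \<Rightarrow> 'a \<Rightarrow> 'a::complex_vector"
  defines cspan = complex_vector.span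
    and cdependent = complex_vector.dependent
    and cdim = complex_vector.dim
  by standard (simp_all add: scaleC_add_right scaleC_add_left scaleC_scaleC scaleC_one)

abbreviation clinear :: "('a::complex_vector \<Rightarrow> 'b::complex_vector) \<Rightarrow> bool" where
  "clinear \<equiv> Vector_Spaces.linear scaleC scaleC"

text \<open>The inner product is linear in its first argument and conjugate linear in its second.\<close>

class complex_inner = complex_vector + real_normed_vector +
  fixes cinner :: "'a \<Rightarrow> 'a \<Rightarrow> complex"
  assumes cinner_commute: "cinner x y = cnj (cinner y x)"
    and cinner_add_left: "cinner (x + y) z = cinner x z + cinner y z"
    and cinner_scaleC_left: "cinner (a *\<^sub>C x) y = a * cinner x y"
    and cinner_self_ge_zero: "0 \<le> Re (cinner x x)"
    and cinner_self_eq_zero_iff: "cinner x x = 0 \<longleftrightarrow> x = 0"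
    and norm_eq_sqrt_cinner: "norm x = sqrt (Re (cinner x x))"

class chilbert_space = complex_inner + complete_space

instantiation complex :: chilbert_space
begin

definition scaleC_complex :: "complex \<Rightarrow> complex \<Rightarrow> complex" where
  "scaleC_complex a x = a * x"

definition cinner_complex :: "complex \<Rightarrow> complex \<Rightarrow> complex" where
  "cinner_complex x y = x * cnj y"

instance
proof
  fix x y z a b :: complex and r :: real
  show "a *\<^sub>C (x + y) = a *\<^sub>C x + a *\<^sub>C y" "(a + b) *\<^sub>C x = a *\<^sub>C x + b *\<^sub>C x"
    "a *\<^sub>C (b *\<^sub>C x) = (a * b) *\<^sub>C x" "1 *\<^sub>C x = x"
    by (simp_all add: scaleC_complex_def distrib_left distrib_right mult.assoc)
  show "complex_of_real r *\<^sub>C x = r *\<^sub>R x"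
    by (simp add: scaleC_complex_def scaleR_conv_of_real)
  show "cinner x y = cnj (cinner y x)" "cinner (x + y) z = cinner x z + cinner y z"
    "cinner (a *\<^sub>C x) y = a * cinner x y"
    by (simp_all add: cinner_complex_def scaleC_complex_def algebra_simps)
  have self: "cinner x x = complex_of_real ((norm x)\<^sup>2)"
    unfolding cinner_complex_def by (rule complex_norm_square [symmetric])
  show "0 \<le> Re (cinner x x)" "cinner x x = 0 \<longleftrightarrow> x = 0" "norm x = sqrt (Re (cinner x x))"
    unfolding self Re_complex_of_real of_real_eq_0_iff by simp_all
qed

end

instantiation vec :: (complex_vector, finite) complex_vector
begin

definition scaleC_vec :: "complex \<Rightarrow> 'a ^ 'b \<Rightarrow> 'a ^ 'b" where
  "scaleC_vec a x = (\<chi> i. a *\<^sub>C x $ i)"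

instance
  by standard
    (simp_all add: vec_eq_iff scaleC_vec_def scaleC_add_right scaleC_add_left scaleC_of_real)

end

instantiation vec :: (complex_inner, finite) complex_inner
begin

definition cinner_vec :: "'a ^ 'b \<Rightarrow> 'a ^ 'b \<Rightarrow> complex" where
  "cinner_vec x y = (\<Sum>i\<in>UNIV. cinner (x $ i) (y $ i))"

instance
proof
  fix x y z :: "'a ^ 'b" and a :: complex
  have self: "cinner u u = complex_of_real ((norm u)\<^sup>2)" for u :: 'a
  proof -
    have "cinner u u = cnj (cinner u u)"
      by (rule cinner_commute)
    then have "Im (cinner u u) = 0"
      by (simp add: complex_eq_iff)
    then show ?thesis
      using cinner_self_ge_zero[of u] by (simp add: complex_eq_iff norm_eq_sqrt_cinner)
  qed
  have self_vec: "cinner x x = complex_of_real (\<Sum>i\<in>UNIV. (norm (x $ i))\<^sup>2)"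
    unfolding cinner_vec_def by (simp add: self)
  show "cinner x y = cnj (cinner y x)"
    unfolding cinner_vec_def cnj_sum by (rule sum.cong) (auto intro: cinner_commute)
  show "cinner (x + y) z = cinner x z + cinner y z"
    by (simp add: cinner_vec_def cinner_add_left sum.distrib)
  show "cinner (a *\<^sub>C x) y = a * cinner x y"
    by (simp add: cinner_vec_def scaleC_vec_def cinner_scaleC_left sum_distrib_left)
  show "0 \<le> Re (cinner x x)"
    unfolding self_vec by (simp add: sum_nonneg)
  show "cinner x x = 0 \<longleftrightarrow> x = 0"
    unfolding self_vec of_real_eq_0_iff by (simp add: sum_nonneg_eq_0_iff vec_eq_iff)
  show "norm x = sqrt (Re (cinner x x))"
    unfolding self_vec by (simp add: norm_vec_def L2_set_def)
qed

end

instance vec :: (chilbert_space, finite) chilbert_space ..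

text \<open>
  Since \<open>cdim\<close> is \<open>0\<close> on spaces without a finite basis, the infinite-dimensional case is
  included separately.
\<close>

definition cdim_at_least :: "nat \<Rightarrow> 'a::complex_vector set \<Rightarrow> bool" where
  "cdim_at_least n V \<longleftrightarrow> (\<exists>B. finite B \<and> V \<subseteq> cspan B) \<longrightarrow> n \<le> cdim V"


section \<open>Bounded operators\<close>

text \<open>
  The operator norm is the library's \<open>onorm\<close>: the supremum of \<open>norm (T x) / norm x\<close> does not
  depend on the scalar field.
\<close>

definition bounded_clinear :: "('a::complex_inner \<Rightarrow> 'b::complex_inner) \<Rightarrow> bool" where
  "bounded_clinear T \<longleftrightarrow> clinear T \<and> bounded_linear T"

text \<open>
  For a bounded operator on a Hilbert space the function chosen here exists by the Riesz
  representation theorem, and it is unique.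
\<close>

definition cadjoint :: "('a::complex_inner \<Rightarrow> 'b::complex_inner) \<Rightarrow> 'b \<Rightarrow> 'a" where
  "cadjoint T = (SOME S. \<forall>x y. cinner (T x) y = cinner x (S y))"

definition positive_semidefinite :: "('a::complex_inner \<Rightarrow> 'a) \<Rightarrow> bool" where
  "positive_semidefinite S \<longleftrightarrow> (\<forall>y. cinner (S y) y \<in> \<real>\<^sub>\<ge>\<^sub>0)"

definition numerical_range :: "('a::complex_inner \<Rightarrow> 'a) \<Rightarrow> complex set" where
  "numerical_range T = {cinner (T y) y | y. norm y = 1}"

definition numerical_radius :: "('a::complex_inner \<Rightarrow> 'a) \<Rightarrow> real" where
  "numerical_radius T = (SUP \<mu>\<in>numerical_range T. norm \<mu>)"


section \<open>Compressions and unitary similarity\<close>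

definition orthogonal_projection :: "'a::complex_inner set \<Rightarrow> 'a \<Rightarrow> 'a" where
  "orthogonal_projection V y = (THE p. p \<in> V \<and> (\<forall>v\<in>V. cinner (y - p) v = 0))"

definition compression :: "'a::complex_inner set \<Rightarrow> ('a \<Rightarrow> 'a) \<Rightarrow> 'a \<Rightarrow> 'a" where
  "compression V X = (\<lambda>v\<in>V. orthogonal_projection V (X v))"

definition unitary_onto :: "('b::complex_inner \<Rightarrow> 'a::complex_inner) \<Rightarrow> 'a set \<Rightarrow> bool" where
  "unitary_onto U V \<longleftrightarrow>
     clinear U \<and> (\<forall>y z. cinner (U y) (U z) = cinner y z) \<and> range U = V"

text \<open>
  \<open>A\<close> is an operator on the subspace \<open>V\<close>; \<open>U\<close> is a unitary from \<open>\<complex>\<^sup>n\<close> onto \<open>V\<close> and the last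
  conjunct says \<open>U\<^sup>* A U = M\<close>.
\<close>

definition unitarily_similar_to_matrix ::
    "'a::complex_inner set \<Rightarrow> ('a \<Rightarrow> 'a) \<Rightarrow> complex ^ 'n ^ 'n \<Rightarrow> bool" where
  "unitarily_similar_to_matrix V A M \<longleftrightarrow>
     (\<exists>U :: complex ^ 'n \<Rightarrow> 'a. unitary_onto U V \<and> (\<forall>z. A (U z) = U (M *v z)))"

definition matrix_B :: "complex ^ 2 ^ 2" where
  "matrix_B = vector [vector [2 / 3, complex_of_real (1 / sqrt 3)],
                      vector [- complex_of_real (1 / sqrt 3), 0]]"

end

theory Submission
  imports Defs
begin

text \<open>
  Normalise \<open>A = T / \<parallel>T\<parallel>\<close>, so that the ratio is \<open>\<surd>2\<close> exactly when \<open>w(A) = 1 / \<surd>2\<close>, and put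
  \<open>y = A x\<close>.  Since \<open>\<parallel>A\<parallel> = 1\<close> is attained at \<open>x\<close>, the vector \<open>x\<close> is fixed by \<open>A\<^sup>*A\<close>, whence
  \<open>\<langle>A y, y\<rangle> = \<langle>y, x\<rangle> = \<langle>A x, x\<rangle>\<close>.  The sesquilinear form of \<open>A\<close> on the span of \<open>x\<close> and \<open>y\<close> is therefore
  known up to the two scalars \<open>a = \<langle>A x, x\<rangle>\<close> and \<open>g = \<langle>A y, x\<rangle>\<close>, because \<open>\<langle>A x, y\<rangle> = 1\<close>.

  Accretivity bounds \<open>Re a\<close> from below by \<open>|1 + g| / 2\<close>, while \<open>w(A) \<le> 1 / \<surd>2\<close>, tested on the two
  vectors \<open>x \<plusminus> \<i> y\<close>, bounds it from above.  The two bounds meet only for \<open>a = 1 / 2\<close> and \<open>g = 0\<close>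
  (\<open>extremal_accretive_contraction\<close>).  These values determine the compression, and in the
  orthonormal basis \<open>(x + y) / \<surd>3\<close>, \<open>x - y\<close> its matrix is \<open>matrix_B\<close>
  (\<open>extremal_similar_matrix_B\<close>).

  Conversely a compression has no larger numerical range, and that of \<open>matrix_B\<close> contains a point
  of modulus \<open>1 / \<surd>2\<close>, so that \<open>w(A) \<ge> 1 / \<surd>2\<close>
  (\<open>similar_matrix_B_numerical_radius_ge\<close>).

  The adjoint and the projection are defined by choice and description.  Their characteristic
  properties come from the Riesz representation theorem: it gives the adjoint of a bounded operator,
  and the projection onto the range of an isometry \<open>U\<close> is then \<open>U U\<^sup>*\<close>.
\<close>

section \<open>Inner products\<close>

lemma cinner_add_right: "cinner x (y + z) = cinner x y + cinner x z"
  by (metis cinner_add_left cinner_commute complex_cnj_add)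

lemma cinner_scaleC_right: "cinner x (a *\<^sub>C y) = cnj a * cinner x y"
  by (metis cinner_commute cinner_scaleC_left complex_cnj_mult)

lemma cinner_scaleR_left: "cinner (r *\<^sub>R x) y = of_real r * cinner x y"
  by (metis cinner_scaleC_left scaleC_of_real)

lemma cinner_scaleR_right: "cinner x (r *\<^sub>R y) = of_real r * cinner x y"
  by (metis cinner_scaleC_right scaleC_of_real complex_cnj_complex_of_real)

lemma cinner_diff_left: "cinner (x - y) z = cinner x z - cinner y z"
  by (metis add_diff_cancel_right' cinner_add_left diff_add_cancel)

lemma cinner_diff_right: "cinner x (y - z) = cinner x y - cinner x z"
  by (metis add_diff_cancel_right' cinner_add_right diff_add_cancel)

lemmas cinner_linear_simps =
  cinner_add_left cinner_add_right cinner_diff_left cinner_diff_right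
  cinner_scaleC_left cinner_scaleC_right cinner_scaleR_left cinner_scaleR_right

lemma Re_cinner_commute: "Re (cinner x y) = Re (cinner y x)"
  using arg_cong[OF cinner_commute[of x y], of Re] by simp

lemma Re_cinner_self: "Re (cinner x x) = (norm x)\<^sup>2"
  using cinner_self_ge_zero[of x] by (simp add: norm_eq_sqrt_cinner)

lemma cinner_self_norm: "cinner x x = complex_of_real ((norm x)\<^sup>2)"
proof -
  have "Im (cinner x x) = 0"
    using arg_cong[OF cinner_commute[of x x], of Im] by simp
  then show ?thesis by (simp add: complex_eq_iff Re_cinner_self)
qed

lemma norm_add_sq: "(norm (x + y))\<^sup>2 = (norm x)\<^sup>2 + 2 * Re (cinner x y) + (norm y)\<^sup>2"
  using Re_cinner_commute[of y x]
  by (simp add: Re_cinner_self[symmetric] cinner_add_left cinner_add_right)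

text \<open>
  The Cauchy-Schwarz inequality, from \<open>\<parallel>n x - c y\<parallel>\<^sup>2 \<ge> 0\<close> with \<open>n = \<parallel>y\<parallel>\<^sup>2\<close> and \<open>c = \<langle>x, y\<rangle>\<close>: this is
  \<open>n\<close> times the residual of projecting \<open>x\<close> onto \<open>y\<close>, which avoids a division.
\<close>

lemma norm_cinner_le: "norm (cinner x y) \<le> norm x * norm y"
proof (cases "y = 0 \<or> cinner x y = 0")
  case True
  then show ?thesis
    by (metis norm_zero mult_nonneg_nonneg norm_ge_zero cinner_scaleC_right
        complex_vector.scale_zero_left complex_cnj_zero mult_zero_left)
next
  case False
  define n where "n = (norm y)\<^sup>2"
  define c where "c = cinner x y"
  have n: "n > 0" using False by (simp add: n_def)
  have "0 \<le> Re (cinner (of_real n *\<^sub>C x - c *\<^sub>C y) (of_real n *\<^sub>C x - c *\<^sub>C y))"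
    by (rule cinner_self_ge_zero)
  also have "cinner (of_real n *\<^sub>C x - c *\<^sub>C y) (of_real n *\<^sub>C x - c *\<^sub>C y)
      = of_real n * (of_real n * of_real ((norm x)\<^sup>2) - c * cnj c)"
    by (simp add: cinner_linear_simps cinner_self_norm[of x] cinner_self_norm[of y] c_def n_def cinner_commute[of y x]
        algebra_simps)
  also have "Re \<dots> = n * (n * (norm x)\<^sup>2 - (norm c)\<^sup>2)"
    by (simp add: complex_mult_cnj cmod_power2 flip: of_real_mult of_real_power)
  finally have "(norm c)\<^sup>2 \<le> (norm x * norm y)\<^sup>2"
    using n by (simp add: zero_le_mult_iff power_mult_distrib n_def mult.commute)
  then show ?thesis
    unfolding c_def by (rule power2_le_imp_le) simp
qed

text \<open>
  The first-order condition at a minimum.  Both uses are variational: the polynomial is the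
  increase of a quadratic functional along a line through a minimiser.
\<close>

lemma linear_coefficient_eq_zero:
  fixes b c :: real
  assumes "\<And>t. 0 \<le> b * t\<^sup>2 + 2 * c * t"
  shows "c = 0"
proof (rule ccontr)
  assume c: "c \<noteq> 0"
  have b: "b \<ge> 0" using assms[of 1] assms[of "-1"] by simp
  have "b * (- c / (b + 1))\<^sup>2 + 2 * c * (- c / (b + 1)) = - (c\<^sup>2 * (b + 2)) / (b + 1)\<^sup>2"
    using b by (simp add: divide_simps) (simp add: algebra_simps power2_eq_square)
  moreover have "- (c\<^sup>2 * (b + 2)) / (b + 1)\<^sup>2 < 0"
    using b c by (intro divide_neg_pos) (auto simp: mult_pos_pos)
  ultimately show False using assms[of "- c / (b + 1)"] by linarith
qed

lemma clinear_add: "clinear T \<Longrightarrow> T (x + y) = T x + T y"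
  by (simp add: Vector_Spaces.linear_iff)

lemma clinear_scaleC: "clinear T \<Longrightarrow> T (a *\<^sub>C x) = a *\<^sub>C T x"
  by (simp add: Vector_Spaces.linear_iff)

lemma clinear_diff: "clinear T \<Longrightarrow> T (x - y) = T x - T y"
  by (metis add_diff_cancel_right' clinear_add diff_add_cancel)

lemma clinear_scaleR: "clinear T \<Longrightarrow> T (r *\<^sub>R x) = r *\<^sub>R T x"
  by (metis clinear_scaleC scaleC_of_real)

section \<open>Riesz representation and the adjoint\<close>

text \<open>
  The representing vector of \<open>r\<close> is the minimiser of \<open>\<parallel>v\<parallel>\<^sup>2 - 2 r(v)\<close>.  By the parallelogram law
  minimising sequences are Cauchy, and stationarity at the limit is the representation.
\<close>

lemma riesz_representation:
  fixes r :: "'a::chilbert_space \<Rightarrow> real"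
  assumes r: "bounded_linear r"
  shows "\<exists>v. \<forall>h. r h = Re (cinner h v)"
proof -
  interpret r: bounded_linear r by (rule r)
  define J where "J v = (norm v)\<^sup>2 - 2 * r v" for v
  obtain K where K: "\<And>v. norm (r v) \<le> norm v * K" using r.bounded by blast
  have J_ge: "- K\<^sup>2 \<le> J v" for v
  proof -
    have "r v \<le> norm v * K" using K[of v] by simp
    moreover have "0 \<le> (norm v - K)\<^sup>2" by simp
    ultimately show ?thesis by (simp add: J_def power2_diff)
  qed
  define m where "m = (INF v. J v)"
  have bdd: "bdd_below (range J)" by (rule bdd_belowI2) (rule J_ge)
  have m_le: "m \<le> J v" for v unfolding m_def by (rule cINF_lower[OF bdd]) simp
  have "\<exists>v. J v < m + 1 / real (Suc n)" for n
  proof -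
    have "(INF v. J v) < m + 1 / real (Suc n)" by (simp add: m_def)
    then show ?thesis using cINF_less_iff[OF _ bdd] by auto
  qed
  then obtain f where f: "\<And>n. J (f n) < m + 1 / real (Suc n)" by metis
  have mid: "(norm (u - v))\<^sup>2 \<le> 2 * (J u - m) + 2 * (J v - m)" for u v
  proof -
    have "4 * J ((1/2) *\<^sub>R (u + v)) = (norm (u + v))\<^sup>2 - 4 * r u - 4 * r v"
      by (simp add: J_def r.scaleR r.add power_divide) (simp add: add_divide_distrib)
    moreover have "(norm (u + v))\<^sup>2 + (norm (u - v))\<^sup>2 = 2 * (norm u)\<^sup>2 + 2 * (norm v)\<^sup>2"
      by (simp add: Re_cinner_self[symmetric] cinner_linear_simps)
    ultimately show ?thesis using m_le[of "(1/2) *\<^sub>R (u + v)"] by (simp add: J_def)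
  qed
  have "Cauchy f"
  proof (rule metric_CauchyI)
    fix e :: real assume e: "0 < e"
    obtain N where N: "inverse (real (Suc N)) < e\<^sup>2 / 4"
      using reals_Archimedean[of "e\<^sup>2 / 4"] e by auto
    have "dist (f i) (f j) < e" if "i \<ge> N" "j \<ge> N" for i j
    proof -
      have small: "J (f k) - m < e\<^sup>2 / 4" if "k \<ge> N" for k
      proof -
        have "1 / real (Suc k) \<le> inverse (real (Suc N))"
          using that by (simp add: inverse_eq_divide frac_le)
        with f[of k] N show ?thesis by linarith
      qed
      have "2 * (J (f i) - m) + 2 * (J (f j) - m) < 2 * (e\<^sup>2 / 4) + 2 * (e\<^sup>2 / 4)"
        using small[OF that(1)] small[OF that(2)] by (intro add_strict_mono) simp_all
      with mid[of "f i" "f j"] have "(norm (f i - f j))\<^sup>2 < e\<^sup>2" by simp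
      then show ?thesis using e by (auto simp: dist_norm intro: power2_less_imp_less)
    qed
    then show "\<exists>M. \<forall>i\<ge>M. \<forall>j\<ge>M. dist (f i) (f j) < e" by blast
  qed
  then obtain v where v: "f \<longlonglongrightarrow> v" using Cauchy_convergent convergent_def by blast
  have "(\<lambda>n. J (f n)) \<longlonglongrightarrow> J v"
    unfolding J_def by (intro tendsto_intros v r.tendsto)
  moreover have "(\<lambda>n. m + 1 / real (Suc n)) \<longlonglongrightarrow> m + 0"
    by (intro tendsto_intros LIMSEQ_Suc[OF lim_1_over_n])
  ultimately have "J v \<le> m + 0"
    by (rule LIMSEQ_le) (use f less_imp_le in blast)
  then have Jv: "J v \<le> m" by simp
  have "r h = Re (cinner h v)" for h
  proof -
    have "0 \<le> (norm h)\<^sup>2 * t\<^sup>2 + 2 * (Re (cinner h v) - r h) * t" for t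
    proof -
      have "J v \<le> J (v + t *\<^sub>R h)" using Jv m_le order_trans by blast
      then show ?thesis
        by (simp add: J_def norm_add_sq r.add r.scaleR cinner_scaleR_right power_mult_distrib
            Re_cinner_commute[of v h] algebra_simps)
    qed
    from linear_coefficient_eq_zero[OF this] show ?thesis by simp
  qed
  then show ?thesis by blast
qed

text \<open>
  The representation of the real part of \<open>\<langle>T x, y\<rangle>\<close> determines the imaginary part as well, through
  \<open>Im c = - Re (\<i> c)\<close>.
\<close>

lemma cadjoint_exists:
  fixes T :: "'a::chilbert_space \<Rightarrow> 'b::complex_inner"
  assumes T: "bounded_clinear T"
  shows "\<exists>S. \<forall>x y. cinner (T x) y = cinner x (S y)"
proof -
  have lin: "clinear T" and bd: "bounded_linear T"
    using T by (auto simp: bounded_clinear_def)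
  have "\<exists>v. \<forall>x. cinner (T x) y = cinner x v" for y
  proof -
    obtain K where K: "\<And>v. norm (T v) \<le> norm v * K"
      using bd bounded_linear.bounded by blast
    have "bounded_linear (\<lambda>x. Re (cinner (T x) y))"
    proof (rule bounded_linear_intro[where K = "K * norm y"])
      fix x
      have "norm (Re (cinner (T x) y)) \<le> norm (T x) * norm y"
        using abs_Re_le_cmod[of "cinner (T x) y"] norm_cinner_le[of "T x" y] by simp
      also have "\<dots> \<le> norm x * K * norm y" by (intro mult_right_mono K) simp
      finally show "norm (Re (cinner (T x) y)) \<le> norm x * (K * norm y)" by (simp add: mult.assoc)
    qed (simp_all add: clinear_add[OF lin] clinear_scaleR[OF lin] cinner_linear_simps)
    then obtain v where v: "\<And>x. Re (cinner (T x) y) = Re (cinner x v)"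
      using riesz_representation by blast
    have "Im (cinner (T x) y) = Im (cinner x v)" for x
      using v[of "\<i> *\<^sub>C x"] by (simp add: clinear_scaleC[OF lin] cinner_scaleC_left)
    then show ?thesis using v by (auto simp: complex_eq_iff)
  qed
  then show ?thesis by metis
qed

lemma cinner_cadjoint:
  fixes T :: "'a::chilbert_space \<Rightarrow> 'b::complex_inner"
  assumes "bounded_clinear T"
  shows "cinner (T x) y = cinner x (cadjoint T y)"
  using someI_ex[OF cadjoint_exists[OF assms]] unfolding cadjoint_def by blast

lemma positive_semidefinite_add_cadjoint:
  fixes T :: "'a::chilbert_space \<Rightarrow> 'a"
  assumes T: "bounded_clinear T" and pos: "positive_semidefinite (\<lambda>y. T y + cadjoint T y)"
  shows "0 \<le> Re (cinner (T v) v)"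
proof -
  have "0 \<le> Re (cinner (T v + cadjoint T v) v)"
    using pos by (auto simp: positive_semidefinite_def complex_nonneg_Reals_iff)
  also have "\<dots> = 2 * Re (cinner (T v) v)"
    using cinner_cadjoint[OF T, of v v] Re_cinner_commute[of "cadjoint T v" v]
    by (simp add: cinner_add_left)
  finally show ?thesis by simp
qed

section \<open>The numerical radius\<close>

lemma norm_cinner_le_numerical_radius:
  assumes T: "bounded_clinear T"
  shows "norm (cinner (T v) v) \<le> numerical_radius T * (norm v)\<^sup>2"
proof (cases "v = 0")
  case True
  then show ?thesis using norm_cinner_le[of "T v" v] by simp
next
  case False
  have lin: "clinear T" and bd: "bounded_linear T"
    using T by (auto simp: bounded_clinear_def)
  have "bdd_above (norm ` numerical_range T)"
  proof (rule bdd_aboveI2)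
    fix \<mu> assume "\<mu> \<in> numerical_range T"
    then obtain y where y: "\<mu> = cinner (T y) y" "norm y = 1"
      by (auto simp: numerical_range_def)
    then show "norm \<mu> \<le> onorm T"
      using norm_cinner_le[of "T y" y] onorm[OF bd, of y] by simp
  qed
  moreover have "cinner (T (v /\<^sub>R norm v)) (v /\<^sub>R norm v) \<in> numerical_range T"
    using False by (auto simp: numerical_range_def)
  ultimately have "norm (cinner (T (v /\<^sub>R norm v)) (v /\<^sub>R norm v)) \<le> numerical_radius T"
    unfolding numerical_radius_def by (rule cSUP_upper[rotated])
  then show ?thesis
    using False
    by (simp add: clinear_scaleR[OF lin] cinner_scaleR_left cinner_scaleR_right norm_mult
        norm_inverse norm_divide field_simps power2_eq_square)
qed

lemma numerical_radius_scaleR_le: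
  assumes T: "bounded_clinear T" and r: "0 \<le> r" and x: "norm (x::'a::complex_inner) = 1"
  shows "numerical_radius (\<lambda>y. r *\<^sub>R T y :: 'a) \<le> r * numerical_radius T"
  unfolding numerical_radius_def[of "\<lambda>y. r *\<^sub>R T y"]
proof (rule cSUP_least)
  show "numerical_range (\<lambda>y. r *\<^sub>R T y) \<noteq> {}"
    using x by (auto simp: numerical_range_def)
next
  fix \<mu> assume "\<mu> \<in> numerical_range (\<lambda>y. r *\<^sub>R T y)"
  then obtain y where y: "\<mu> = of_real r * cinner (T y) y" "norm y = 1"
    by (auto simp: numerical_range_def cinner_scaleR_left)
  then show "norm \<mu> \<le> r * numerical_radius T"
    using norm_cinner_le_numerical_radius[OF T, of y] r
    by (simp add: norm_mult mult_left_mono)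
qed

lemma bounded_clinear_scaleR:
  fixes T :: "'a::complex_inner \<Rightarrow> 'b::complex_inner"
  assumes "bounded_clinear T"
  shows "bounded_clinear (\<lambda>y. r *\<^sub>R T y)"
proof -
  have "r *\<^sub>R c *\<^sub>C v = c *\<^sub>C r *\<^sub>R v" for c and v :: 'b
    by (metis scaleC_of_real complex_vector.scale_left_commute)
  then show ?thesis
    using assms unfolding bounded_clinear_def
    by (auto intro: bounded_linear_scaleR_right[THEN bounded_linear_compose]
        simp: Vector_Spaces.linear_iff scaleR_add_right)
qed

lemma numerical_radius_scaleR:
  assumes T: "bounded_clinear T" and r: "0 < r" and x: "norm (x::'a::complex_inner) = 1"
  shows "numerical_radius (\<lambda>y. r *\<^sub>R T y :: 'a) = r * numerical_radius T"
proof (rule antisym)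
  show "numerical_radius (\<lambda>y. r *\<^sub>R T y) \<le> r * numerical_radius T"
    using numerical_radius_scaleR_le[OF T _ x] r by simp
  have "numerical_radius (\<lambda>y. inverse r *\<^sub>R (r *\<^sub>R T y))
      \<le> inverse r * numerical_radius (\<lambda>y. r *\<^sub>R T y)"
    using numerical_radius_scaleR_le[OF bounded_clinear_scaleR[OF T] _ x, of "inverse r" r] r
    by simp
  then show "r * numerical_radius T \<le> numerical_radius (\<lambda>y. r *\<^sub>R T y)"
    using r by (simp add: field_simps)
qed

section \<open>Compressions onto the range of an isometry\<close>

lemma unitary_onto_norm:
  assumes "unitary_onto U V"
  shows "norm (U z) = norm z"
  using assms by (simp add: unitary_onto_def norm_eq_sqrt_cinner)

lemma unitary_onto_bounded_clinear:
  assumes "unitary_onto U V"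
  shows "bounded_clinear U"
proof -
  have lin: "clinear U" using assms by (simp add: unitary_onto_def)
  have "bounded_linear U"
    by (rule bounded_linear_intro[where K = 1])
      (simp_all add: clinear_add[OF lin] clinear_scaleR[OF lin] unitary_onto_norm[OF assms])
  with lin show ?thesis by (simp add: bounded_clinear_def)
qed

lemma orthogonal_projection_eqI:
  assumes U: "unitary_onto U V" and "p \<in> V" and "\<And>v. v \<in> V \<Longrightarrow> cinner (y - p) v = 0"
  shows "orthogonal_projection V y = p"
  unfolding orthogonal_projection_def
proof (rule the_equality)
  show "p \<in> V \<and> (\<forall>v\<in>V. cinner (y - p) v = 0)" using assms by blast
next
  fix q assume q: "q \<in> V \<and> (\<forall>v\<in>V. cinner (y - q) v = 0)"
  have lin: "clinear U" and V: "V = range U" using U by (auto simp: unitary_onto_def)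
  obtain a b where "q = U a" "p = U b" using q \<open>p \<in> V\<close> V by blast
  then have "q - p \<in> V" by (simp add: V flip: clinear_diff[OF lin])
  then have "cinner ((y - p) - (y - q)) (q - p) = 0"
    using q assms(3) by (simp add: cinner_diff_left)
  then show "q = p" by (simp add: cinner_self_eq_zero_iff)
qed

text \<open>The projection onto the range of an isometry \<open>U\<close> is \<open>U U\<^sup>*\<close>.\<close>

lemma cinner_orthogonal_projection:
  fixes U :: "'b::chilbert_space \<Rightarrow> 'a::complex_inner"
  assumes U: "unitary_onto U V"
  shows "cinner (orthogonal_projection V y) (U w) = cinner y (U w)"
proof -
  define p where "p = U (cadjoint U y)"
  have iso: "\<And>a b. cinner (U a) (U b) = cinner a b" and V: "V = range U"
    using U by (auto simp: unitary_onto_def)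
  have p: "cinner p (U w) = cinner y (U w)" for w
    using cinner_cadjoint[OF unitary_onto_bounded_clinear[OF U], of w y]
    by (metis cinner_commute iso p_def)
  have "orthogonal_projection V y = p"
    by (rule orthogonal_projection_eqI[OF U]) (auto simp: V p cinner_diff_left, simp add: p_def)
  then show ?thesis using p by simp
qed

text \<open>
  A compression is determined by its sesquilinear form, so that unitary similarity becomes a
  statement about inner products of vectors of the ambient space.
\<close>

lemma compression_eq_matrix_iff:
  fixes U :: "complex ^ 'n \<Rightarrow> 'a::complex_inner"
  assumes U: "unitary_onto U V"
  shows "(\<forall>z. compression V A (U z) = U (M *v z)) \<longleftrightarrow>
    (\<forall>z w. cinner (A (U z)) (U w) = cinner (M *v z) w)"
proof -
  have iso: "\<And>a b. cinner (U a) (U b) = cinner a b" and V: "V = range U"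
    using U by (auto simp: unitary_onto_def)
  have comp: "compression V A (U z) = orthogonal_projection V (A (U z))" for z
    by (simp add: compression_def V)
  show ?thesis
  proof safe
    fix z w assume "\<forall>z. compression V A (U z) = U (M *v z)"
    then show "cinner (A (U z)) (U w) = cinner (M *v z) w"
      by (metis comp cinner_orthogonal_projection[OF U] iso)
  next
    fix z assume "\<forall>z w. cinner (A (U z)) (U w) = cinner (M *v z) w"
    then show "compression V A (U z) = U (M *v z)"
      unfolding comp by (intro orthogonal_projection_eqI[OF U]) (auto simp: V iso cinner_diff_left)
  qed
qed

section \<open>The extremal configuration\<close>

text \<open>
  \<open>A\<^sup>*A x = x\<close> at a vector where a contraction is isometric: \<open>x\<close> minimises the nonnegative form
  \<open>\<parallel>v\<parallel>\<^sup>2 - \<parallel>A v\<parallel>\<^sup>2\<close>.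
\<close>

lemma cinner_image_norm_attaining:
  assumes A: "clinear A" and contr: "\<And>v. norm (A v) \<le> norm v" and x: "norm (A x) = norm x"
  shows "cinner (A v) (A x) = cinner v x"
proof -
  have Re: "Re (cinner (A v) (A x)) = Re (cinner v x)" for v
  proof -
    have "0 \<le> ((norm v)\<^sup>2 - (norm (A v))\<^sup>2) * t\<^sup>2
        + 2 * (Re (cinner v x) - Re (cinner (A v) (A x))) * t" for t
    proof -
      have "(norm (A x + t *\<^sub>R A v))\<^sup>2 \<le> (norm (x + t *\<^sub>R v))\<^sup>2"
        using contr[of "x + t *\<^sub>R v"]
        by (simp add: clinear_add[OF A] clinear_scaleR[OF A] power_mono)
      then show ?thesis
        by (simp add: norm_add_sq x cinner_scaleR_right power_mult_distrib
            Re_cinner_commute[of x v] Re_cinner_commute[of "A x" "A v"] algebra_simps)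
    qed
    from linear_coefficient_eq_zero[OF this] show ?thesis by simp
  qed
  have "Im (cinner (A v) (A x)) = Im (cinner v x)"
    using Re[of "\<i> *\<^sub>C v"] by (simp add: clinear_scaleC[OF A] cinner_scaleC_left)
  with Re show ?thesis by (simp add: complex_eq_iff)
qed

text \<open>
  The Cauchy-Schwarz inequality for the positive semidefinite form of \<open>A + A\<^sup>*\<close>, whose
  off-diagonal entry is \<open>\<langle>A x, y\<rangle> + cnj \<langle>A y, x\<rangle>\<close>, in the case of equal diagonal entries.
\<close>

lemma accretive_cauchy_schwarz:
  assumes A: "clinear A" and acc: "\<And>v. 0 \<le> Re (cinner (A v) v)"
    and eq: "Re (cinner (A y) y) = Re (cinner (A x) x)"
  shows "norm (cinner (A x) y + cnj (cinner (A y) x)) \<le> 2 * Re (cinner (A x) x)"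
proof -
  define p q where "p = cinner (A x) y" and "q = cinner (A y) x"
  define h where "h = p + cnj q"
  define n where "n = complex_of_real (norm h)"
  have hh: "cnj h * h = n * n"
    using complex_norm_square[of h] by (simp add: n_def power2_eq_square mult.commute)
  have "Re (cnj h * p + h * q) = Re (cnj h * h)"
    by (simp add: h_def algebra_simps)
  then have cross: "Re (cnj h * p + h * q) = (norm h)\<^sup>2"
    by (simp add: hh n_def power2_eq_square)
  \<comment> \<open>The relative phase of the test vector makes the cross term real and negative; both
    coefficients have modulus \<open>|h|\<close>, so no division by \<open>h\<close> is needed.\<close>
  have "0 \<le> Re (cinner (A (n *\<^sub>C y - cnj h *\<^sub>C x)) (n *\<^sub>C y - cnj h *\<^sub>C x))" by (rule acc)
  also have "cinner (A (n *\<^sub>C y - cnj h *\<^sub>C x)) (n *\<^sub>C y - cnj h *\<^sub>C x)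
      = n * n * cinner (A y) y + cnj h * h * cinner (A x) x - n * (cnj h * p + h * q)"
    by (simp add: clinear_diff[OF A] clinear_scaleC[OF A] cinner_linear_simps p_def q_def n_def
        algebra_simps)
  also have "Re \<dots> = (norm h)\<^sup>2 * (2 * Re (cinner (A x) x)) - norm h * Re (cnj h * p + h * q)"
    unfolding hh by (simp add: n_def eq power2_eq_square algebra_simps)
  also have "\<dots> = (norm h)\<^sup>2 * (2 * Re (cinner (A x) x) - norm h)"
    unfolding cross by (simp add: algebra_simps)
  finally have "h = 0 \<or> norm h \<le> 2 * Re (cinner (A x) x)"
    by (auto simp: zero_le_mult_iff)
  then show ?thesis using acc[of x] by (auto simp: h_def p_def q_def)
qed

text \<open>
  The heart of the matter.  With \<open>y = A x\<close>, \<open>a = \<langle>A x, x\<rangle> = \<langle>A y, y\<rangle>\<close> and \<open>g = \<langle>A y, x\<rangle>\<close>, the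
  numerical radius bound at \<open>x \<plusminus> \<i> y\<close> and accretivity give
  \<open>|1 + g|\<^sup>2 + |1 - g|\<^sup>2 + 2 (Im a)\<^sup>2 \<le> 4 (Re a)\<^sup>2 + 2 (Im a)\<^sup>2 + |1 - g|\<^sup>2 \<le> 2\<close>,
  and the left-hand side is \<open>2 + 2 |g|\<^sup>2 + 2 (Im a)\<^sup>2\<close>.
\<close>

lemma extremal_accretive_contraction:
  assumes A: "clinear A" and x1: "norm x = 1" and contr: "\<And>v. norm (A v) \<le> norm v"
    and Ax1: "norm (A x) = 1" and acc: "\<And>v. 0 \<le> Re (cinner (A v) v)"
    and w: "\<And>v. norm (cinner (A v) v) \<le> 1 / sqrt 2 * (norm v)\<^sup>2"
  shows "cinner (A x) x = 1 / 2" "cinner (A (A x)) x = 0" "cinner (A (A x)) (A x) = 1 / 2"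
proof -
  define y where "y = A x"
  define a where "a = cinner (A x) x"
  define g where "g = cinner (A y) x"
  have Ayy: "cinner (A y) y = a"
    using cinner_image_norm_attaining[OF A contr, of x y] x1 Ax1 by (simp add: y_def a_def)
  have y1: "norm y = 1" using Ax1 by (simp add: y_def)
  have Axy: "cinner (A x) y = 1"
    using cinner_self_norm[of y] y1 by (simp add: y_def)
  have xy: "cinner y x = a" "cinner x y = cnj a"
    using cinner_commute[of x y] by (simp_all add: y_def a_def)
  have "norm (1 + cnj g) \<le> 2 * Re a"
    using accretive_cauchy_schwarz[OF A acc, of y x] Ayy Axy by (simp add: a_def g_def)
  then have "(norm (1 + cnj g))\<^sup>2 \<le> (2 * Re a)\<^sup>2" by (intro power_mono) auto
  then have ge: "(1 + Re g)\<^sup>2 + (Im g)\<^sup>2 \<le> 4 * (Re a)\<^sup>2"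
    by (simp add: cmod_power2 power_mult_distrib)
  \<comment> \<open>Adding the two cases \<open>s = 1\<close> and \<open>s = -1\<close> cancels the cross terms in \<open>a (1 - g)\<close> and the
    linear terms in \<open>Im a\<close>.\<close>
  have sq: "(norm (2 * a - s * \<i> * (1 - g)))\<^sup>2 \<le> 2 * (1 - Re s * Im a)\<^sup>2"
    if s: "s = 1 \<or> s = -1" for s
  proof -
    let ?v = "x + (s * \<i>) *\<^sub>C y"
    have F: "cinner (A ?v) ?v = 2 * a - s * \<i> * (1 - g)"
      using s
      by (auto simp: clinear_add[OF A] clinear_scaleC[OF A] clinear_diff[OF A] cinner_linear_simps
          Ayy Axy a_def[symmetric] g_def[symmetric] algebra_simps)
    have N: "(norm ?v)\<^sup>2 = 2 * (1 - Re s * Im a)"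
      using s x1 y1 cinner_self_norm[of x] cinner_self_norm[of y]
      by (auto simp: Re_cinner_self[symmetric] cinner_linear_simps xy)
    have k: "1 / sqrt 2 * (2 * k) = sqrt 2 * k" for k :: real by (simp add: field_simps)
    have "norm (2 * a - s * \<i> * (1 - g)) \<le> sqrt 2 * (1 - Re s * Im a)"
      using w[of ?v] unfolding F N k .
    then have "(norm (2 * a - s * \<i> * (1 - g)))\<^sup>2 \<le> (sqrt 2 * (1 - Re s * Im a))\<^sup>2"
      by (intro power_mono) auto
    then show ?thesis by (simp add: power_mult_distrib)
  qed
  have le: "4 * (Re a)\<^sup>2 + 2 * (Im a)\<^sup>2 + (1 - Re g)\<^sup>2 + (Im g)\<^sup>2 \<le> 2"
    using sq[of 1] sq[of "-1"]
    by (simp add: cmod_power2) (simp add: power2_eq_square algebra_simps)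
  have "(Re g)\<^sup>2 + (Im g)\<^sup>2 + (Im a)\<^sup>2 \<le> 0"
    using ge le by (simp add: power2_eq_square algebra_simps)
  then have z: "Re g = 0" "Im g = 0" "Im a = 0"
    by (smt (verit) zero_le_power2 zero_eq_power2)+
  then have "(2 * Re a)\<^sup>2 = 1\<^sup>2" using ge le by (simp add: power_mult_distrib)
  moreover have "Re a \<ge> 0" using acc[of x] by (simp add: a_def)
  ultimately have "2 * Re a = 1" by (simp only: power2_eq_iff) auto
  then have "a = 1 / 2" "g = 0" using z by (simp_all add: complex_eq_iff)
  then show "cinner (A x) x = 1 / 2" "cinner (A (A x)) x = 0" "cinner (A (A x)) (A x) = 1 / 2"
    using Ayy by (simp_all add: a_def g_def y_def)
qed

lemma matrix_B_mult:
  "(matrix_B *v z) $ 1 = 2 / 3 * z $ 1 + of_real (1 / sqrt 3) * z $ 2"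
  "(matrix_B *v z) $ 2 = - of_real (1 / sqrt 3) * z $ 1"
  by (simp_all add: matrix_B_def matrix_vector_mult_def sum_2)

lemma cinner_vec_2: "cinner z w = z $ 1 * cnj (w $ 1) + z $ 2 * cnj (w $ 2)" for z w :: "complex ^ 2"
  by (simp add: cinner_vec_def sum_2 cinner_complex_def)

text \<open>
  In the extremal configuration the hermitian part of the compression annihilates \<open>x - A x\<close>, and
  \<open>x + A x\<close> is orthogonal to \<open>x - A x\<close>.  This is the eigenbasis in which the matrix is taken,
  since the hermitian part of \<open>matrix_B\<close> is diagonal.
\<close>

lemma extremal_similar_matrix_B:
  assumes A: "clinear A" and x1: "norm x = 1" and Ax1: "norm (A x) = 1"
    and ext: "cinner (A x) x = 1 / 2" "cinner (A (A x)) x = 0" "cinner (A (A x)) (A x) = 1 / 2"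
  shows "unitarily_similar_to_matrix (cspan {x, A x}) (compression (cspan {x, A x}) A) matrix_B"
proof -
  define y where "y = A x"
  define s where "s = complex_of_real (1 / sqrt 3)"
  define U :: "complex ^ 2 \<Rightarrow> 'a"
    where "U z = (s * z $ 1 + z $ 2) *\<^sub>C x + (s * z $ 1 - z $ 2) *\<^sub>C y" for z
  have ss: "s * s = 1 / 3"
    by (simp add: s_def flip: of_real_mult)
  then have ssl: "s * (s * c) = c / 3" for c by (simp flip: mult.assoc)
  have cnjs: "cnj s = s" by (simp add: s_def)
  have xx: "cinner x x = 1" "cinner y y = 1"
    using x1 Ax1 by (simp_all add: cinner_self_norm y_def)
  have yx': "cinner y x = 1 / 2" using ext(1) by (simp add: y_def)
  have yx: "cinner y x = 1 / 2" "cinner x y = 1 / 2"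
    by (fact yx') (subst cinner_commute, simp add: yx')
  have Axy: "A x = y" "cinner (A y) x = 0" "cinner (A y) y = 1 / 2"
    using ext by (simp_all add: y_def)
  have lin: "clinear U"
    by (simp add: Vector_Spaces.linear_iff complex_vector.vector_space_axioms U_def scaleC_vec_def
        scaleC_complex_def scaleC_add_right scaleC_scaleC algebra_simps flip: scaleC_add_left)
  have iso: "cinner (U z) (U w) = cinner z w" for z w
    by (simp add: U_def cinner_linear_simps xx yx cinner_vec_2 cnjs algebra_simps ssl)
  have B: "(matrix_B *v z) $ 1 = 2 / 3 * z $ 1 + s * z $ 2" "(matrix_B *v z) $ 2 = - s * z $ 1" for z
    by (simp_all only: matrix_B_mult s_def)
  have form: "cinner (A (U z)) (U w) = cinner (matrix_B *v z) w" for z w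
    by (simp add: U_def clinear_add[OF A] clinear_diff[OF A] clinear_scaleC[OF A] cinner_linear_simps xx yx Axy
        cinner_vec_2 B cnjs algebra_simps ssl)
  have ran: "range U = cspan {x, y}"
  proof (intro subset_antisym subsetI)
    fix v assume "v \<in> range U"
    then show "v \<in> cspan {x, y}"
      by (auto simp: U_def intro!: complex_vector.span_add complex_vector.span_scale
          intro: complex_vector.span_base)
  next
    fix v assume "v \<in> cspan {x, y}"
    then obtain p q where v: "v = p *\<^sub>C x + q *\<^sub>C y"
      by (auto simp: complex_vector.span_insert complex_vector.span_empty algebra_simps)
    \<comment> \<open>The factor \<open>3 * s\<close> is \<open>\<surd>3\<close>, the inverse of \<open>s\<close>.\<close>
    have "v = U (vector [3 * s * (p + q) / 2, (p - q) / 2])"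
      by (simp add: U_def v algebra_simps ssl add_divide_distrib diff_divide_distrib)
    then show "v \<in> range U" by blast
  qed
  have "unitary_onto U (cspan {x, y})"
    using lin iso ran by (simp add: unitary_onto_def)
  with form compression_eq_matrix_iff[of U "cspan {x, y}" A matrix_B]
  show ?thesis unfolding unitarily_similar_to_matrix_def y_def by blast
qed

text \<open>
  The numerical range of \<open>matrix_B\<close> contains \<open>(1 + \<i>) / 2\<close>, and compression does not enlarge
  numerical ranges.  At the unit vector \<open>(cos t, \<i> sin t)\<close> the form of \<open>matrix_B\<close> is
  \<open>(1 + cos 2t) / 3 + (\<i> / \<surd>3) sin 2t\<close>, whose modulus is largest for \<open>t = \<pi> / 6\<close>.
\<close>

lemma similar_matrix_B_numerical_radius_ge:
  assumes A: "bounded_clinear A"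
    and sim: "unitarily_similar_to_matrix V (compression V A) matrix_B"
  shows "1 / sqrt 2 \<le> numerical_radius A"
proof -
  obtain U :: "complex ^ 2 \<Rightarrow> 'a" where U: "unitary_onto U V"
    and "\<forall>z. compression V A (U z) = U (matrix_B *v z)"
    using sim by (auto simp: unitarily_similar_to_matrix_def)
  then have form: "cinner (A (U z)) (U w) = cinner (matrix_B *v z) w" for z w
    using compression_eq_matrix_iff by blast
  define z :: "complex ^ 2" where "z = vector [of_real (sqrt 3 / 2), \<i> / 2]"
  have val: "cinner (A (U z)) (U z) = (1 + \<i>) / 2"
    unfolding form
    by (simp add: cinner_vec_2 matrix_B_mult z_def complex_eq_iff field_simps)
  have "cinner z z = 1"
    by (simp add: cinner_vec_2 z_def complex_eq_iff)
  then have "norm (U z) = 1"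
    unfolding unitary_onto_norm[OF U] by (simp add: norm_eq_sqrt_cinner)
  then have "norm ((1 + \<i>) / 2) \<le> numerical_radius A"
    using norm_cinner_le_numerical_radius[OF A, of "U z"] unfolding val by simp
  then show ?thesis by (simp add: cmod_def power_divide real_sqrt_divide)
qed

theorem theorem3p8:
  fixes T :: "'a::chilbert_space \<Rightarrow> 'a" and x :: 'a
  assumes dim: "cdim_at_least 3 (UNIV :: 'a set)"
    and T_bounded: "bounded_clinear T"
    and T_nonzero: "T \<noteq> (\<lambda>y. 0)"
    and T_accretive: "positive_semidefinite (\<lambda>y. T y + cadjoint T y)"
    and x_unit: "norm x = 1"
    and norm_attained: "norm (T x) = onorm T"
  defines "T' \<equiv> (\<lambda>y. T y /\<^sub>R onorm T)"
  shows "onorm T / numerical_radius T = sqrt 2 \<longleftrightarrow>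
    unitarily_similar_to_matrix (cspan {x, T x}) (compression (cspan {x, T x}) T') matrix_B \<and>
    numerical_radius T' \<le> 1 / sqrt 2"
proof -
  have bd: "bounded_linear T" using T_bounded by (simp add: bounded_clinear_def)
  have pos: "0 < onorm T" using T_nonzero onorm_pos_lt[OF bd] by blast
  have bT': "bounded_clinear T'"
    unfolding T'_def by (rule bounded_clinear_scaleR[OF T_bounded])
  have lin': "clinear T'" using bT' by (simp add: bounded_clinear_def)
  have contr: "norm (T' v) \<le> norm v" for v
    using onorm[OF bd, of v] pos by (simp add: T'_def field_simps)
  have T'x: "norm (T' x) = 1" using norm_attained pos by (simp add: T'_def)
  have acc: "0 \<le> Re (cinner (T' v) v)" for v
    using positive_semidefinite_add_cadjoint[OF T_bounded T_accretive, of v] pos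
    by (simp add: T'_def cinner_scaleR_left)
  have rad: "numerical_radius T' = numerical_radius T / onorm T"
    using numerical_radius_scaleR[OF T_bounded _ x_unit, of "inverse (onorm T)"] pos
    by (simp add: T'_def field_simps)
  have span: "cspan {x, T x} = cspan {x, T' x}"
  proof (rule complex_vector.span_eq[THEN iffD2], safe)
    have "T x = of_real (onorm T) *\<^sub>C T' x" "T' x = of_real (inverse (onorm T)) *\<^sub>C T x"
      using pos by (simp_all add: T'_def scaleC_of_real del: of_real_inverse)
    then show "T x \<in> cspan {x, T' x}" "T' x \<in> cspan {x, T x}"
      by (metis complex_vector.span_scale complex_vector.span_base insertI1 insertI2)+
  qed (auto intro: complex_vector.span_base)
  have ratio: "onorm T / numerical_radius T = sqrt 2 \<longleftrightarrow> numerical_radius T' = 1 / sqrt 2"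
    using pos unfolding rad by (cases "numerical_radius T = 0") (auto simp: field_simps)
  show ?thesis
    unfolding ratio span
  proof safe
    assume w: "numerical_radius T' = 1 / sqrt 2"
    then have "norm (cinner (T' v) v) \<le> 1 / sqrt 2 * (norm v)\<^sup>2" for v
      using norm_cinner_le_numerical_radius[OF bT', of v] by simp
    note ext = extremal_accretive_contraction[OF lin' x_unit contr T'x acc this]
    show "unitarily_similar_to_matrix (cspan {x, T' x}) (compression (cspan {x, T' x}) T') matrix_B"
      by (rule extremal_similar_matrix_B[OF lin' x_unit T'x ext])
    show "numerical_radius T' \<le> 1 / sqrt 2" using w by simp
  next
    assume "unitarily_similar_to_matrix (cspan {x, T' x}) (compression (cspan {x, T' x}) T') matrix_B"
      and "numerical_radius T' \<le> 1 / sqrt 2"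
    then show "numerical_radius T' = 1 / sqrt 2"
      using similar_matrix_B_numerical_radius_ge[OF bT'] by (intro antisym)
  qed
qed

end
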